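(* Assume that $\alpha\in DC(a)$ for some $a\geq 1$. Then for every $0<\gamma<\frac{1}{(1+a)a}$ there exists a $\gamma$-Hölder continuous function $\varphi:\mathbb{T}\to\mathbb{R}$ with zero mean ($\int_{\mathbb{T}}\varphi\,dx=0$) such that the cylindrical transformation $T_\varphi:\mathbb{T}\times\mathbb{R}\to\mathbb{T}\times\mathbb{R}$, $T_\varphi(x,s)=(x+\alpha,s+\varphi(x))$, is Besicovitch.
   Context: $\mathbb{T}=\mathbb{R}/\mathbb{Z}$. For $a\ge 1$, $DC(a)$ is the set of irrational $\alpha\in\mathbb{T}$ for which there is a constant $C>0$ with $\left|\alpha-\frac pq\right|\ge\frac{1}{C|q|^{1+a}}$ for all $p,q\in\mathbb{Z}$, $q\ne0$. For $n\in\mathbb{Z}$: $\varphi^{(n)}(x)=\sum_{k=0}^{n-1}\varphi(x+k\alpha)$ for $n>0$, $\varphi^{(0)}=0$, $\varphi^{(n)}(x)=-\sum_{k=1}^{|n|}\varphi(x-k\alpha)$ for $n<0$. The orbit of $(x,t)$ under $T_\varphi$ is called discrete if $|\varphi^{(n)}(x)|\to+\infty$ as $|n|\to+\infty$. $T_\varphi$ is called Besicovitch if it has both a dense (two-sided) orbit and a discrete orbit. *)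

theory Defs
  imports "HOL-Analysis.Analysis"
begin

section \<open>The circle \<open>\<real>/\<int>\<close>\<close>

quotient_type circle = real / "\<lambda>x y. x - y \<in> \<int>"
  morphisms rep_circle to_circle
proof (rule equivpI)
  show "reflp (\<lambda>x y::real. x - y \<in> \<int>)"
    by (simp add: reflp_def)
  show "symp (\<lambda>x y::real. x - y \<in> \<int>)"
    by (metis (mono_tags, lifting) sympI Ints_minus minus_diff_eq)
  show "transp (\<lambda>x y::real. x - y \<in> \<int>)"
  proof (rule transpI)
    fix x y z :: real
    assume "x - y \<in> \<int>" "y - z \<in> \<int>"
    then have "(x - y) + (y - z) \<in> \<int>" by (rule Ints_add)
    then show "x - z \<in> \<int>" by simp
  qed
qed

instantiation circle :: ab_group_add
begin

lift_definition zero_circle :: circle is 0 .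

lift_definition plus_circle :: "circle \<Rightarrow> circle \<Rightarrow> circle" is "(+)"
proof -
  fix a b c d :: real
  assume "a - b \<in> \<int>" "c - d \<in> \<int>"
  then have "(a - b) + (c - d) \<in> \<int>" by (rule Ints_add)
  then show "a + c - (b + d) \<in> \<int>" by (simp add: algebra_simps)
qed

lift_definition uminus_circle :: "circle \<Rightarrow> circle" is "uminus"
  by (metis Ints_minus minus_diff_eq minus_diff_minus)

lift_definition minus_circle :: "circle \<Rightarrow> circle \<Rightarrow> circle" is "(-)"
proof -
  fix a b c d :: real
  assume "a - b \<in> \<int>" "c - d \<in> \<int>"
  then have "(a - b) - (c - d) \<in> \<int>" by (rule Ints_diff)
  then show "a - c - (b - d) \<in> \<int>" by (simp add: algebra_simps)
qed

instance
  by standard (transfer, simp add: algebra_simps)+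

end

lift_definition int_mult :: "int \<Rightarrow> circle \<Rightarrow> circle" is "\<lambda>k x. of_int k * x"
  by (metis Ints_mult Ints_of_int right_diff_distrib)

text \<open>
  The distance on the circle is the distance of a difference to the nearest integer,
  i.e. the quotient metric; \<open>open_circle_iff\<close> below shows that it induces the
  quotient topology.
\<close>

lemma infdist_Ints_cong:
  fixes x y :: real
  assumes "x - y \<in> \<int>"
  shows "infdist x \<int> = infdist y \<int>"
proof -
  have le: "infdist u \<int> \<le> infdist v \<int>" if "u - v \<in> \<int>" for u v :: real
  proof -
    obtain m where m: "m \<in> \<int>" "infdist v \<int> = dist v m"
      using infdist_attains_inf[of "\<int> :: real set" v] closed_Ints Ints_0 by blast
    have "m + (u - v) \<in> \<int>" using m that by (intro Ints_add)
    then have "infdist u \<int> \<le> dist u (m + (u - v))" by (rule infdist_le)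
    then show ?thesis using m by (simp add: dist_real_def)
  qed
  have "y - x \<in> \<int>" using assms by (metis Ints_minus minus_diff_eq)
  then show ?thesis using le[OF assms] le[of y x] by simp
qed

lemma infdist_Ints_attained:
  fixes x :: real
  obtains m where "m \<in> \<int>" "infdist x \<int> = \<bar>x - m\<bar>"
  using infdist_attains_inf[of "\<int> :: real set" x] closed_Ints Ints_0
  by (metis dist_real_def empty_iff)

instantiation circle :: metric_space
begin

lift_definition dist_circle :: "circle \<Rightarrow> circle \<Rightarrow> real"
  is "\<lambda>x y. infdist (x - y) \<int>"
proof (rule infdist_Ints_cong)
  fix a b c d :: real
  assume "a - b \<in> \<int>" "c - d \<in> \<int>"
  then have "(a - b) - (c - d) \<in> \<int>" by (rule Ints_diff)
  then show "a - c - (b - d) \<in> \<int>" by (simp add: algebra_simps)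
qed

definition uniformity_circle :: "(circle \<times> circle) filter" where
  "uniformity_circle = (INF e\<in>{0<..}. principal {(x, y). dist x y < e})"

definition open_circle :: "circle set \<Rightarrow> bool" where
  "open_circle U \<longleftrightarrow> (\<forall>x\<in>U. eventually (\<lambda>(x', y). x' = x \<longrightarrow> y \<in> U) uniformity)"

instance
proof
  show "dist x y = 0 \<longleftrightarrow> x = y" for x y :: circle
  proof transfer
    fix x y :: real
    show "infdist (x - y) \<int> = 0 \<longleftrightarrow> x - y \<in> \<int>"
      using in_closed_iff_infdist_zero[of "\<int> :: real set" "x - y"] closed_Ints Ints_0 by blast
  qed
  show "dist x y \<le> dist x z + dist y z" for x y z :: circle
  proof transfer
    fix x y z :: real
    obtain m where m: "m \<in> \<int>" "infdist (x - z) \<int> = \<bar>x - z - m\<bar>"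
      by (rule infdist_Ints_attained)
    obtain n where n: "n \<in> \<int>" "infdist (y - z) \<int> = \<bar>y - z - n\<bar>"
      by (rule infdist_Ints_attained)
    have "infdist (x - y) \<int> \<le> dist (x - y) (m - n)"
      using m n by (intro infdist_le Ints_diff)
    then show "infdist (x - y) \<int> \<le> infdist (x - z) \<int> + infdist (y - z) \<int>"
      using m n by (simp add: dist_real_def)
  qed
qed (simp_all add: uniformity_circle_def open_circle_def)

end

lemma dist_to_circle: "dist (to_circle x) (to_circle y) = infdist (x - y) \<int>"
  by transfer simp

lemma to_circle_eq_iff: "to_circle x = to_circle y \<longleftrightarrow> x - y \<in> \<int>"
  by transfer simp

lemma continuous_on_to_circle: "continuous_on A to_circle"
proof -
  have "dist (to_circle x) (to_circle y) \<le> dist x y" for x y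
    using infdist_le[of 0 "\<int> :: real set" "x - y"] by (simp add: dist_to_circle dist_real_def)
  then show ?thesis
    unfolding continuous_on_iff by (meson le_less_trans)
qed

lemma open_circle_iff: "open U \<longleftrightarrow> open (to_circle -` U)"
proof
  show "open (to_circle -` U)" if "open U"
    using that continuous_on_to_circle[of UNIV] by (simp add: continuous_on_open_vimage)
next
  assume U: "open (to_circle -` U)"
  show "open U"
    unfolding open_dist
  proof
    fix c assume c: "c \<in> U"
    obtain x where x: "c = to_circle x" by (metis Quotient3_circle Quotient3_abs_rep)
    with c U obtain e where e: "e > 0" "\<And>y. dist y x < e \<Longrightarrow> to_circle y \<in> U"
      unfolding open_dist by auto
    have "d \<in> U" if d: "dist d c < e" for d
    proof -
      obtain y where y: "d = to_circle y" by (metis Quotient3_circle Quotient3_abs_rep)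
      obtain m where m: "m \<in> \<int>" "infdist (y - x) \<int> = \<bar>y - x - m\<bar>"
        by (rule infdist_Ints_attained)
      have "to_circle (y - m) \<in> U"
        using d m by (intro e) (simp add: x y dist_to_circle dist_real_def algebra_simps)
      moreover have "to_circle (y - m) = d"
        using m by (simp add: y to_circle_eq_iff)
      ultimately show ?thesis by simp
    qed
    with e show "\<exists>e>0. \<forall>d. dist d c < e \<longrightarrow> d \<in> U" by blast
  qed
qed

definition circle_measure :: "circle measure" where
  "circle_measure = distr (restrict_space lborel {0..<1}) borel to_circle"

lemma integral_circle_measure:
  fixes f :: "circle \<Rightarrow> real"
  assumes "f \<in> borel_measurable borel"
  shows "integral\<^sup>L circle_measure f = (LINT x:{0..<1}|lborel. f (to_circle x))"
proof -
  have "to_circle \<in> borel_measurable borel"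
    by (rule borel_measurable_continuous_onI[OF continuous_on_to_circle])
  then have "to_circle \<in> borel_measurable (restrict_space lborel {0..<1})"
    by (intro measurable_restrict_space1) simp
  then have "integral\<^sup>L circle_measure f
      = (\<integral>x. f (to_circle x) \<partial>restrict_space lborel {0..<1})"
    unfolding circle_measure_def using assms by (rule integral_distr)
  then show ?thesis
    by (simp add: integral_restrict_space set_lebesgue_integral_def)
qed

definition holder_continuous :: "real \<Rightarrow> ('a::metric_space \<Rightarrow> 'b::metric_space) \<Rightarrow> bool" where
  "holder_continuous \<gamma> f \<longleftrightarrow> (\<exists>K. \<forall>x y. dist (f x) (f y) \<le> K * dist x y powr \<gamma>)"


section \<open>Diophantine rotations\<close>

text \<open>
  Irrationality and the Diophantine inequalities (over all \<open>p\<close>) do not depend on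
  the chosen representative \<open>x\<close> of a point of the circle.
\<close>

definition DC :: "real \<Rightarrow> circle set" where
  "DC a = {to_circle x | x. x \<notin> \<rat> \<and>
     (\<exists>C>0. \<forall>p q :: int. q \<noteq> 0 \<longrightarrow>
        \<bar>x - of_int p / of_int q\<bar> \<ge> 1 / (C * \<bar>of_int q\<bar> powr (1 + a)))}"


section \<open>Cylindrical transformations\<close>

definition cylindrical :: "circle \<Rightarrow> (circle \<Rightarrow> real) \<Rightarrow> circle \<times> real \<Rightarrow> circle \<times> real" where
  "cylindrical \<alpha> \<phi> = (\<lambda>(x, s). (x + \<alpha>, s + \<phi> x))"

definition cocycle :: "circle \<Rightarrow> (circle \<Rightarrow> real) \<Rightarrow> int \<Rightarrow> circle \<Rightarrow> real" where
  "cocycle \<alpha> \<phi> n x =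
     (if n \<ge> 0 then (\<Sum>k = 0..<n. \<phi> (x + int_mult k \<alpha>))
      else - (\<Sum>k = 1..\<bar>n\<bar>. \<phi> (x - int_mult k \<alpha>)))"

definition two_sided_orbit :: "('a \<Rightarrow> 'a) \<Rightarrow> 'a \<Rightarrow> 'a set" where
  "two_sided_orbit T p = range (\<lambda>n. (T ^^ n) p) \<union> range (\<lambda>n. (inv T ^^ n) p)"

definition dense_orbit :: "circle \<Rightarrow> (circle \<Rightarrow> real) \<Rightarrow> circle \<times> real \<Rightarrow> bool" where
  "dense_orbit \<alpha> \<phi> p \<longleftrightarrow> closure (two_sided_orbit (cylindrical \<alpha> \<phi>) p) = UNIV"

definition discrete_orbit :: "circle \<Rightarrow> (circle \<Rightarrow> real) \<Rightarrow> circle \<times> real \<Rightarrow> bool" where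
  "discrete_orbit \<alpha> \<phi> p \<longleftrightarrow>
     filterlim (\<lambda>n. \<bar>cocycle \<alpha> \<phi> n (fst p)\<bar>) at_top (filtercomap abs at_top)"

definition besicovitch :: "circle \<Rightarrow> (circle \<Rightarrow> real) \<Rightarrow> bool" where
  "besicovitch \<alpha> \<phi> \<longleftrightarrow> (\<exists>p. dense_orbit \<alpha> \<phi> p) \<and> (\<exists>p. discrete_orbit \<alpha> \<phi> p)"

lemma bij_cylindrical: "bij (cylindrical \<alpha> \<phi>)"
  by (rule o_bij[where g = "\<lambda>(x, s). (x - \<alpha>, s - \<phi> (x - \<alpha>))"])
    (auto simp: cylindrical_def fun_eq_iff)

lemma inv_cylindrical: "inv (cylindrical \<alpha> \<phi>) = (\<lambda>(x, s). (x - \<alpha>, s - \<phi> (x - \<alpha>)))"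
  by (rule inv_equality) (auto simp: cylindrical_def)

lemma int_mult_0: "int_mult 0 x = 0"
  by transfer simp

lemma int_mult_add: "int_mult (m + n) x = int_mult m x + int_mult n x"
  by transfer (simp add: algebra_simps)

lemma int_mult_1: "int_mult 1 x = x"
  by transfer simp

lemma funpow_cylindrical:
  "(cylindrical \<alpha> \<phi> ^^ n) (x, s) = (x + int_mult (int n) \<alpha>, s + cocycle \<alpha> \<phi> (int n) x)"
proof (induction n)
  case 0
  show ?case by (simp add: int_mult_0 cocycle_def)
next
  case (Suc n)
  have "{0..<1 + int n} = insert (int n) {0..<int n}" by auto
  with Suc show ?case
    by (simp add: cylindrical_def cocycle_def int_mult_add int_mult_1 algebra_simps)
qed

lemma funpow_inv_cylindrical:
  "(inv (cylindrical \<alpha> \<phi>) ^^ n) (x, s)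
     = (x - int_mult (int n) \<alpha>, s + cocycle \<alpha> \<phi> (- int n) x)"
proof (induction n)
  case 0
  show ?case by (simp add: int_mult_0 cocycle_def)
next
  case (Suc n)
  have *: "{1..int n + 1} = insert (1 + int n) {1..int n}" by auto
  have "cocycle \<alpha> \<phi> (- int (Suc n)) x
      = cocycle \<alpha> \<phi> (- int n) x - \<phi> (x - int_mult (int (Suc n)) \<alpha>)"
    using * by (auto simp: cocycle_def)
  with Suc show ?case
    by (simp add: inv_cylindrical int_mult_add int_mult_1 algebra_simps)
qed

end

theory Submission
  imports Defs
begin

text \<open>
  A continuous zero-mean cocycle over an irrational rotation with a discrete orbit automatically has
  a dense orbit: otherwise some level is never attained by \<open>\<phi>\<^sup>(\<^sup>n\<^sup>)\<close> on returns to some ball, and since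
  each \<open>\<phi>\<^sup>(\<^sup>n\<^sup>)\<close> has a zero, connectedness bounds \<open>\<phi>\<^sup>(\<^sup>n\<^sup>)\<close> uniformly along all \<open>n\<close> with \<open>n\<alpha>\<close> close to
  \<open>0\<close>. So only a discrete orbit has to be produced. Dirichlet's theorem gives \<open>0 < q\<^sub>k \<le> 2\<^sup>k\<close> with
  \<open>\<parallel>q\<^sub>k\<alpha>\<parallel> \<le> 2\<^sup>-\<^sup>k\<close>, and \<open>\<phi>\<close> is a sum of coboundaries of the functions
  \<open>x \<mapsto> 2\<^sup>\<eta>\<^sup>k 2\<^sup>-\<^sup>k \<parallel>q\<^sub>k x\<parallel> / \<parallel>q\<^sub>k\<alpha>\<parallel>\<close>, all minimal at \<open>0\<close>, so that the contributions to \<open>\<phi>\<^sup>(\<^sup>n\<^sup>)(0)\<close> do not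
  cancel and the one with \<open>2\<^sup>k \<approx> 2\<bar>n\<bar>\<close> is of order \<open>\<bar>n\<bar>\<^sup>\<eta>\<close>. The Diophantine condition bounds the
  Lipschitz constants of the summands; interpolating with their sup norms \<open>2\<^sup>\<eta>\<^sup>k 2\<^sup>-\<^sup>k\<close> gives Hoelder
  continuity for every exponent below \<open>1 / (1 + a)\<close>.
\<close>

section \<open>The circle as a compact metric group\<close>

lemma circle_cases:
  obtains t where "x = to_circle t" "0 \<le> t" "t < 1"
proof -
  obtain s where s: "x = to_circle s" by (metis Quotient3_circle Quotient3_abs_rep)
  have "x = to_circle (frac s)" by (simp add: s to_circle_eq_iff frac_def)
  then show thesis using that frac_ge_0 frac_lt_1 by blast
qed

lemma to_circle_add: "to_circle (s + t) = to_circle s + to_circle t"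
  by (simp add: plus_circle.abs_eq)

lemma to_circle_minus: "to_circle (- t) = - to_circle t"
  by (simp add: uminus_circle.abs_eq)

lemma to_circle_0: "to_circle 0 = 0"
  by (simp add: zero_circle.abs_eq)

lemma int_mult_to_circle: "int_mult k (to_circle t) = to_circle (of_int k * t)"
  by (simp add: int_mult.abs_eq)

lemma int_mult_add_right: "int_mult k (x + y) = int_mult k x + int_mult k y"
  by transfer (simp add: algebra_simps)

lemma int_mult_assoc: "int_mult k (int_mult m x) = int_mult (k * m) x"
  by transfer (simp add: algebra_simps)

lemma int_mult_zero: "int_mult k 0 = 0"
  by transfer simp

lemma int_mult_minus_left: "int_mult (- k) x = - int_mult k x"
  by transfer simp

lemma int_mult_minus_right: "int_mult k (- x) = - int_mult k x"
  by transfer simp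

lemma dist_circle_add [simp]: "dist (x + z) (y + z) = dist x (y :: circle)"
  by transfer simp

lemma dist_circle_add_left [simp]: "dist (z + x) (z + y) = dist x (y :: circle)"
  by transfer simp

lemma dist_circle_diff: "dist x y = dist (x - y) (0 :: circle)"
  by transfer simp

lemma dist_circle_minus [simp]: "dist (- x) (- y) = dist x (y :: circle)"
  using dist_circle_add[of "- x" "x + y" "- y"] by (simp add: dist_commute)

lemma dist_circle_le: "dist (to_circle s) (to_circle t) \<le> \<bar>s - t\<bar>"
  using infdist_le[of 0 "\<int> :: real set" "s - t"] by (simp add: dist_to_circle dist_real_def)

text \<open>Subtracting a nearest integer from any lift gives a signed lift whose absolute value is
  the distance; estimates on the circle thus become estimates on the line.\<close>

lemma dist_circle_obtain:
  obtains t where "dist x (0 :: circle) = \<bar>t\<bar>" "x = to_circle t"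
proof -
  obtain s where s: "x = to_circle s" by (rule circle_cases)
  obtain m where m: "m \<in> \<int>" "infdist s \<int> = \<bar>s - m\<bar>" by (rule infdist_Ints_attained)
  have "x = to_circle (s - m)" using m(1) by (simp add: s to_circle_eq_iff)
  moreover have "dist x 0 = \<bar>s - m\<bar>"
    using m(2) dist_to_circle[of s 0] by (simp add: s to_circle_0)
  ultimately show thesis using that by blast
qed

lemma dist_int_mult_le: "dist (int_mult k x) 0 \<le> \<bar>of_int k\<bar> * dist x 0"
proof -
  obtain t where t: "dist x 0 = \<bar>t\<bar>" "x = to_circle t" by (rule dist_circle_obtain)
  show ?thesis
    using dist_circle_le[of "of_int k * t" 0] t
    by (simp add: int_mult_to_circle to_circle_0 abs_mult)
qed

text \<open>A lift other than \<open>t\<close> differs from it by at least 1, so its absolute value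
  is at least 1/2 and cannot be smaller than that of \<open>t\<close>.\<close>

lemma dist_to_circle_small:
  assumes "\<bar>t\<bar> \<le> 1 / 2"
  shows "dist (to_circle t) 0 = \<bar>t\<bar>"
proof -
  obtain s where s: "dist (to_circle t) 0 = \<bar>s\<bar>" "to_circle t = to_circle s"
    by (rule dist_circle_obtain)
  obtain m :: int where m: "t - s = of_int m"
    using s(2) by (auto simp: to_circle_eq_iff elim: Ints_cases)
  have le: "dist (to_circle t) 0 \<le> \<bar>t\<bar>"
    using dist_circle_le[of t 0] by (simp add: to_circle_0)
  show ?thesis
  proof (cases "m = 0")
    case True
    then show ?thesis using m s by simp
  next
    case False
    then have "1 \<le> \<bar>real_of_int m\<bar>" by linarith
    then show ?thesis using m s le assms by linarith
  qed
qed

text \<open>Up to distance 1/2 a multiple does not wrap around the circle. This exactness yields the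
  lower bound for the cocycle at 0.\<close>

lemma dist_int_mult_small:
  assumes "\<bar>of_int k\<bar> * dist x 0 \<le> 1 / 2"
  shows "dist (int_mult k x) 0 = \<bar>of_int k\<bar> * dist x 0"
proof -
  obtain t where t: "dist x 0 = \<bar>t\<bar>" "x = to_circle t" by (rule dist_circle_obtain)
  show ?thesis
    using dist_to_circle_small[of "of_int k * t"] assms t
    by (simp add: int_mult_to_circle abs_mult)
qed

lemma compact_UNIV_circle: "compact (UNIV :: circle set)"
proof -
  have "(UNIV :: circle set) = to_circle ` {0..1}"
    by (metis (no_types, opaque_lifting) UNIV_eq_I atLeastAtMost_iff circle_cases image_eqI less_imp_le)
  then show ?thesis
    by (metis compact_Icc compact_continuous_image continuous_on_to_circle)
qed

text \<open>Serves to transfer connectedness of intervals to balls on the circle, and to lift points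
  close to a given one to nearby reals.\<close>

lemma ball_circle: "ball (to_circle t) r = to_circle ` ball t r"
proof (intro equalityI subsetI)
  fix y assume y: "y \<in> ball (to_circle t) r"
  obtain s where s: "dist (y - to_circle t) 0 = \<bar>s\<bar>" "y - to_circle t = to_circle s"
    by (rule dist_circle_obtain)
  have "y = to_circle (t + s)" using s(2) by (simp add: to_circle_add algebra_simps)
  moreover have "t + s \<in> ball t r"
    using y s(1) dist_circle_diff[of y "to_circle t"] by (simp add: dist_real_def dist_commute)
  ultimately show "y \<in> to_circle ` ball t r" by blast
next
  fix y assume "y \<in> to_circle ` ball t r"
  then show "y \<in> ball (to_circle t) r"
    using dist_circle_le by (fastforce simp: dist_real_def intro: le_less_trans)
qed

lemma connected_ball_circle: "connected (ball (c :: circle) r)"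
proof -
  obtain t where "c = to_circle t" by (rule circle_cases)
  then show ?thesis
    by (simp add: ball_circle connected_continuous_image continuous_on_to_circle)
qed

lemma connected_UNIV_circle: "connected (UNIV :: circle set)"
proof -
  have "(UNIV :: circle set) = to_circle ` UNIV" by (metis UNIV_eq_I circle_cases rangeI)
  then show ?thesis
    by (metis connected_continuous_image connected_UNIV continuous_on_to_circle)
qed

lemma continuous_on_circle_add:
  fixes f :: "circle \<Rightarrow> 'a::topological_space"
  assumes "continuous_on UNIV f"
  shows "continuous_on UNIV (\<lambda>x. f (x + z))"
proof -
  have "continuous_on UNIV (\<lambda>x :: circle. x + z)"
    unfolding continuous_on_iff by auto
  then show ?thesis
    using continuous_on_compose2[OF assms] by blast
qed

lemma continuous_on_circle_minus:
  fixes f :: "circle \<Rightarrow> 'a::topological_space"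
  assumes "continuous_on UNIV f"
  shows "continuous_on UNIV (\<lambda>x. f (- x))"
proof -
  have "continuous_on UNIV (\<lambda>x :: circle. - x)"
    unfolding continuous_on_iff by auto
  then show ?thesis
    using continuous_on_compose2[OF assms] by blast
qed


section \<open>Integration over the circle\<close>

lemma continuous_on_comp_to_circle:
  fixes f :: "circle \<Rightarrow> real"
  assumes "continuous_on UNIV f"
  shows "continuous_on A (\<lambda>t. f (to_circle t))"
  using continuous_on_compose2[OF assms continuous_on_to_circle] by blast

lemma integrable_circle_measure:
  fixes f :: "circle \<Rightarrow> real"
  assumes f: "continuous_on UNIV f"
  shows "integrable circle_measure f"
proof -
  have m: "to_circle \<in> borel_measurable (restrict_space lborel {0..<1})"
    by (intro measurable_restrict_space1)
      (simp add: borel_measurable_continuous_onI[OF continuous_on_to_circle])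
  have "set_integrable lborel {0..1} (\<lambda>t. f (to_circle t))"
    by (rule borel_integrable_atLeastAtMost'[OF continuous_on_comp_to_circle[OF f]])
  then have "set_integrable lborel {0..<1} (\<lambda>t. f (to_circle t))"
    by (rule set_integrable_subset) auto
  then have "integrable (restrict_space lborel {0..<1}) (\<lambda>t. f (to_circle t))"
    by (simp add: integrable_restrict_space set_integrable_def)
  then show ?thesis
    unfolding circle_measure_def
    using integrable_distr_eq[OF m borel_measurable_continuous_onI[OF f]] by simp
qed

text \<open>The half-open and the closed unit interval differ by a null set; on the closed one,
  shifts, reflections and splittings of the integral are at hand.\<close>

lemma integral_circle:
  fixes f :: "circle \<Rightarrow> real"
  assumes f: "continuous_on UNIV f"
  shows "(\<integral>x. f x \<partial>circle_measure) = integral {0..1} (\<lambda>t. f (to_circle t))"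
proof -
  let ?F = "\<lambda>t. f (to_circle t)"
  have F: "continuous_on A ?F" for A by (rule continuous_on_comp_to_circle[OF f])
  have "f \<in> borel_measurable borel" by (rule borel_measurable_continuous_onI[OF f])
  then have "(\<integral>x. f x \<partial>circle_measure) = (LINT t:{0..<1}|lborel. ?F t)"
    by (rule integral_circle_measure)
  also have "\<dots> = integral {0..<1} ?F"
  proof (rule set_borel_integral_eq_integral(2))
    have "set_integrable lborel {0..1} ?F"
      by (rule borel_integrable_atLeastAtMost'[OF F])
    then show "set_integrable lborel {0..<1} ?F"
      by (rule set_integrable_subset) auto
  qed
  also have "\<dots> = integral {0..1} ?F"
    by (rule integral_spike_set) (auto intro: negligible_subset[of "{1}"])
  finally show ?thesis .
qed

text \<open>The shifted period \<open>{b..1 + b}\<close> is cut at 1, and the piece beyond 1 is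
  moved back by periodicity.\<close>

lemma integral_circle_translate:
  fixes f :: "circle \<Rightarrow> real"
  assumes f: "continuous_on UNIV f"
  shows "(\<integral>x. f (x + z) \<partial>circle_measure) = (\<integral>x. f x \<partial>circle_measure)"
proof -
  obtain b where b: "z = to_circle b" "0 \<le> b" "b < 1" by (rule circle_cases)
  let ?F = "\<lambda>t. f (to_circle t)"
  have "continuous_on A ?F" for A by (rule continuous_on_comp_to_circle[OF f])
  then have int: "?F integrable_on {s..t}" for s t by (rule integrable_continuous_real)
  have per: "?F \<circ> (+) 1 = ?F" by (auto simp: fun_eq_iff to_circle_eq_iff intro!: arg_cong[of _ _ f])
  have "integral {0..1} (\<lambda>t. f (to_circle t + z)) = integral {0..1} (?F \<circ> (+) b)"
    by (simp add: o_def b to_circle_add add.commute)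
  also have "\<dots> = integral {b..1 + b} ?F"
    by (simp add: integral_shift_Icc_real)
  also have "\<dots> = integral {b..1} ?F + integral {1..1 + b} ?F"
    by (rule Henstock_Kurzweil_Integration.integral_combine[symmetric]) (use b int in auto)
  also have "integral {1..1 + b} ?F = integral {0..b} ?F"
    using integral_shift_Icc_real[of 0 b ?F 1] by (simp add: per add.commute)
  also have "integral {b..1} ?F + integral {0..b} ?F = integral {0..1} ?F"
    using Henstock_Kurzweil_Integration.integral_combine[of 0 b 1 ?F] b int by simp
  finally show ?thesis
    by (simp add: integral_circle f continuous_on_circle_add)
qed

lemma integral_circle_reflect:
  fixes f :: "circle \<Rightarrow> real"
  assumes f: "continuous_on UNIV f"
  shows "(\<integral>x. f (- x) \<partial>circle_measure) = (\<integral>x. f x \<partial>circle_measure)"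
proof -
  let ?F = "\<lambda>t. f (to_circle t)"
  have per: "?F \<circ> (+) (- 1) = ?F"
    by (auto simp: fun_eq_iff to_circle_eq_iff intro!: arg_cong[of _ _ f])
  have "integral {0..1} (\<lambda>t. f (- to_circle t)) = integral {-1..0} ?F"
    using Henstock_Kurzweil_Integration.integral_reflect_real[of 0 "- 1" ?F]
    by (simp add: to_circle_minus)
  also have "\<dots> = integral {0..1} ?F"
    using integral_shift_Icc_real[of 0 1 ?F "-1"] by (simp add: per)
  finally show ?thesis
    by (simp add: integral_circle f continuous_on_circle_minus)
qed

text \<open>A strict sign everywhere would force a nonzero integral, so values of both weak signs
  occur, and the connected image contains 0.\<close>

lemma integral_circle_zero_obtain:
  fixes f :: "circle \<Rightarrow> real"
  assumes f: "continuous_on UNIV f" and int: "(\<integral>x. f x \<partial>circle_measure) = 0"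
  obtains z where "f z = 0"
proof -
  let ?F = "\<lambda>t. f (to_circle t)"
  have F: "continuous_on A ?F" for A by (rule continuous_on_comp_to_circle[OF f])
  have int0: "integral {0..1} ?F = 0" using int by (simp add: integral_circle f)
  have pos: "\<exists>x. f x \<le> 0"
  proof (rule ccontr)
    assume "\<nexists>x. f x \<le> 0"
    then have "f x > 0" for x by (simp add: not_le)
    then have "integral {0..1} (\<lambda>t. 0) < integral {0..1} ?F"
      using integral_less_real[OF continuous_on_const F, of 0 1 0] by simp
    with int0 show False by simp
  qed
  have neg: "\<exists>x. f x \<ge> 0"
  proof (rule ccontr)
    assume "\<nexists>x. f x \<ge> 0"
    then have "f x < 0" for x by (simp add: not_le)
    then have "integral {0..1} ?F < integral {0..1} (\<lambda>t. 0)"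
      using integral_less_real[OF F continuous_on_const, of 0 1 0] by simp
    with int0 show False by simp
  qed
  have "connected (range f)"
    by (rule connected_continuous_image[OF f connected_UNIV_circle])
  then have "0 \<in> range f"
    using pos neg unfolding connected_iff_interval by blast
  then show thesis using that by force
qed


section \<open>Cocycles and density of orbits\<close>

lemma cocycle_0: "cocycle \<alpha> \<phi> 0 x = 0"
  by (simp add: cocycle_def)

lemma cocycle_plus_1: "cocycle \<alpha> \<phi> (n + 1) x = cocycle \<alpha> \<phi> n x + \<phi> (x + int_mult n \<alpha>)"
proof (cases "n \<ge> 0")
  case True
  then have "{0..<n + 1} = insert n {0..<n}" by auto
  with True show ?thesis by (simp add: cocycle_def)
next
  case False
  \<comment> \<open>For negative \<open>n\<close>, passing to \<open>n + 1\<close> drops the summand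
    \<open>k = - n\<close>, which is \<open>\<phi> (x + int_mult n \<alpha>)\<close>. For
    \<open>n = - 1\<close> the result falls into the other branch of the definition, with an empty
    sum.\<close>
  then have "{1..- n} = insert (- n) {1..- (n + 1)}" by auto
  then have "(\<Sum>k = 1..- n. \<phi> (x - int_mult k \<alpha>))
      = \<phi> (x + int_mult n \<alpha>) + (\<Sum>k = 1..- (n + 1). \<phi> (x - int_mult k \<alpha>))"
    by (simp add: int_mult_minus_left)
  with False show ?thesis
    by (cases "n + 1 = 0") (auto simp: cocycle_def)
qed

text \<open>Increments determine a two-sided sequence once its value at 0 is known. Later identities
  are checked through the recursion, without separating the signs of \<open>n\<close>.\<close>

lemma cocycle_unique:
  assumes 0: "c 0 = 0" and step: "\<And>n. c (n + 1) = c n + \<phi> (x + int_mult n \<alpha>)"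
  shows "cocycle \<alpha> \<phi> n x = c n"
proof (induction n rule: int_induct[of _ 0])
  case base
  then show ?case by (simp add: 0 cocycle_0)
next
  case (step1 i)
  then show ?case by (simp add: cocycle_plus_1 step)
next
  case (step2 i)
  then show ?case
    using cocycle_plus_1[of \<alpha> \<phi> "i - 1" x] step[of "i - 1"] by simp
qed

lemma cocycle_add:
  "cocycle \<alpha> \<phi> (m + n) x = cocycle \<alpha> \<phi> m x + cocycle \<alpha> \<phi> n (x + int_mult m \<alpha>)"
proof -
  have "cocycle \<alpha> \<phi> n (x + int_mult m \<alpha>) = cocycle \<alpha> \<phi> (m + n) x - cocycle \<alpha> \<phi> m x"
    by (rule cocycle_unique)
      (simp_all add: cocycle_plus_1 int_mult_add flip: add.assoc)
  then show ?thesis by simp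
qed

lemma cocycle_uminus: "cocycle \<alpha> \<phi> (- n) (x + int_mult n \<alpha>) = - cocycle \<alpha> \<phi> n x"
  using cocycle_add[of \<alpha> \<phi> n "- n" x] by (simp add: cocycle_0)

lemma continuous_on_cocycle:
  assumes "continuous_on UNIV \<phi>"
  shows "continuous_on UNIV (cocycle \<alpha> \<phi> n)"
proof -
  have "continuous_on UNIV (\<lambda>x. \<phi> (x - z))" for z
    using continuous_on_circle_add[OF assms, of "- z"] by simp
  then show ?thesis
    unfolding cocycle_def[abs_def]
    by (cases "n \<ge> 0") (auto intro!: continuous_intros continuous_on_circle_add assms)
qed

lemma integral_cocycle:
  assumes "continuous_on UNIV \<phi>" and "(\<integral>x. \<phi> x \<partial>circle_measure) = 0"
  shows "(\<integral>x. cocycle \<alpha> \<phi> n x \<partial>circle_measure) = 0"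
proof -
  have "(\<integral>x. \<phi> (x - z) \<partial>circle_measure) = 0" for z
    using integral_circle_translate[OF assms(1), of "- z"] assms(2) by simp
  moreover have "continuous_on UNIV (\<lambda>x. \<phi> (x - z))" for z
    using continuous_on_circle_add[OF assms(1), of "- z"] by simp
  ultimately show ?thesis
    unfolding cocycle_def using assms
    by (cases "n \<ge> 0")
      (auto simp: integral_circle_translate Bochner_Integration.integral_sum
        integrable_circle_measure continuous_on_circle_add)
qed

lemma two_sided_orbit_cylindrical:
  "two_sided_orbit (cylindrical \<alpha> \<phi>) (x, s)
     = range (\<lambda>n. (x + int_mult n \<alpha>, s + cocycle \<alpha> \<phi> n x))" (is "_ = range ?f")
proof -
  have "?f n \<in> range (\<lambda>n. ?f (int n)) \<union> range (\<lambda>n. ?f (- int n))" for n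
    by (cases n rule: int_cases2) auto
  then show ?thesis
    unfolding two_sided_orbit_def funpow_cylindrical funpow_inv_cylindrical
    by (force simp: int_mult_minus_left)
qed

section \<open>Density and recurrence of irrational rotations\<close>

lemma int_mult_irrational_nonzero:
  assumes "t \<notin> \<rat>" "k \<noteq> 0"
  shows "int_mult k (to_circle t) \<noteq> 0"
proof
  assume "int_mult k (to_circle t) = 0"
  then obtain m where "of_int k * t = of_int m"
    by (metis Ints_cases diff_zero int_mult_to_circle to_circle_0 to_circle_eq_iff)
  then have "t = of_int m / of_int k" using assms(2) by (simp add: field_simps)
  then show False using assms(1) by simp
qed

lemma rotation_dense:
  assumes t: "t \<notin> \<rat>" and "e > 0"
  obtains n where "dist (x + int_mult n (to_circle t)) y < e"
proof -
  obtain s where s: "y - x = to_circle s" by (rule circle_cases)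
  obtain h k where "\<bar>of_int k * t - of_int h - s\<bar> < e"
    using sequence_of_fractional_parts_is_dense[OF t \<open>e > 0\<close>, of s] by blast
  then have "dist (to_circle (of_int k * t - of_int h)) (to_circle s) < e"
    using dist_circle_le le_less_trans by blast
  moreover have "to_circle (of_int k * t - of_int h) = int_mult k (to_circle t)"
    by (simp add: int_mult_to_circle to_circle_eq_iff)
  ultimately have "dist (int_mult k (to_circle t)) (y - x) < e" by (simp add: s)
  then have "dist (x + int_mult k (to_circle t)) y < e"
    using dist_circle_add[of "int_mult k (to_circle t)" x "y - x"] by (simp add: add.commute)
  then show thesis by (rule that)
qed

text \<open>Dirichlet's theorem gives a positive return time that may be too early. Its multiple by
  \<open>\<bar>N\<bar> + 1\<close> is late enough, and the distance grows at most by that factor,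
  which the choice of \<open>M\<close> absorbs.\<close>

lemma rotation_return:
  assumes t: "t \<notin> \<rat>" and e: "e > 0"
  obtains n where "n \<ge> N" "dist (int_mult n (to_circle t)) 0 < e"
proof -
  obtain M :: nat where M: "\<bar>of_int N\<bar> + 1 < real M * e"
    using ex_less_of_nat_mult[OF e] by blast
  then have M0: "M > 0" by (cases "M = 0") auto
  obtain h k where k: "0 < k" "k \<le> int M" "\<bar>of_int k * t - of_int h\<bar> < 1 / M"
    using Dirichlet_approx[OF M0] by metis
  define n where "n = (\<bar>N\<bar> + 1) * k"
  have "int_mult n (to_circle t) = int_mult (\<bar>N\<bar> + 1) (to_circle (of_int k * t - of_int h))"
    by (simp add: n_def flip: int_mult_assoc)
      (simp add: int_mult_to_circle to_circle_eq_iff algebra_simps)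
  then have "dist (int_mult n (to_circle t)) 0
      \<le> \<bar>of_int (\<bar>N\<bar> + 1)\<bar> * dist (to_circle (of_int k * t - of_int h)) 0"
    by (simp only: dist_int_mult_le)
  also have "\<dots> \<le> \<bar>of_int (\<bar>N\<bar> + 1)\<bar> * (1 / M)"
    using dist_circle_le[of "of_int k * t - of_int h" 0] k(3)
    by (intro mult_left_mono) (auto simp: to_circle_0)
  also have "\<dots> < e" using M M0 by (simp add: field_simps)
  finally have "dist (int_mult n (to_circle t)) 0 < e" .
  moreover have "n \<ge> N"
  proof -
    have "N \<le> (\<bar>N\<bar> + 1) * 1" by simp
    also have "\<dots> \<le> n" unfolding n_def using k(1) by (intro mult_left_mono) auto
    finally show ?thesis .
  qed
  ultimately show thesis using that by blast
qed

section \<open>From a discrete orbit to a dense orbit\<close>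

lemma discrete_orbit_iff:
  "discrete_orbit \<alpha> \<phi> p
     \<longleftrightarrow> (\<forall>Z. \<exists>N. \<forall>n. \<bar>n\<bar> \<ge> N \<longrightarrow> \<bar>cocycle \<alpha> \<phi> n (fst p)\<bar> \<ge> Z)"
  unfolding discrete_orbit_def filterlim_at_top eventually_filtercomap_at_top_linorder by simp

text \<open>By density the translates of the ball along the rotation cover the circle; compactness
  leaves finitely many.\<close>

lemma finite_translates_cover:
  assumes t: "t \<notin> \<rat>" and r: "r > 0"
  obtains M :: "int set" where "finite M"
    "\<And>y. \<exists>m\<in>M. \<exists>x\<in>ball c r. y = x + int_mult m (to_circle t)"
proof -
  let ?B = "\<lambda>m. ball (c + int_mult m (to_circle t)) r"
  have "UNIV \<subseteq> (\<Union>m. ?B m)"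
  proof
    fix y
    obtain n where "dist (c + int_mult n (to_circle t)) y < r"
      by (rule rotation_dense[OF t r])
    then show "y \<in> (\<Union>m. ?B m)" by auto
  qed
  then obtain M where M: "finite M" "UNIV \<subseteq> (\<Union>m\<in>M. ?B m)"
    by (rule compactE_image[OF compact_UNIV_circle, rotated]) auto
  have "\<exists>m\<in>M. \<exists>x\<in>ball c r. y = x + int_mult m (to_circle t)" for y
  proof -
    obtain m where m: "m \<in> M" "y \<in> ?B m" using M(2) by blast
    have "y - int_mult m (to_circle t) \<in> ball c r"
      using m(2) dist_circle_add[of c "int_mult m (to_circle t)" "y - int_mult m (to_circle t)"]
      by simp
    then show ?thesis using m(1) by force
  qed
  then show thesis using that M(1) by blast
qed

text \<open>
  If neither \<open>v\<close> nor \<open>-v\<close> is attained, then for every \<open>n\<close> with \<open>n\<alpha>\<close> close to \<open>0\<close> the interval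
  \<open>\<phi>\<^sup>(\<^sup>n\<^sup>)(ball c (r/2))\<close> misses \<open>\<plusminus>v\<close>. Transporting a zero of \<open>\<phi>\<^sup>(\<^sup>n\<^sup>)\<close> into the ball by one of finitely many
  rotations shows that this interval lies in \<open>(-v, v)\<close>, and transporting back bounds \<open>\<phi>\<^sup>(\<^sup>n\<^sup>)\<close> by
  \<open>2v\<close> on the whole circle. This contradicts the discrete orbit.
\<close>
lemma cocycle_attains:
  assumes t: "t \<notin> \<rat>" and \<phi>: "continuous_on UNIV \<phi>" "(\<integral>x. \<phi> x \<partial>circle_measure) = 0"
    and disc: "discrete_orbit (to_circle t) \<phi> p"
    and r: "r > 0" and v: "v \<noteq> 0"
  obtains n x where "x \<in> ball c r" "x + int_mult n (to_circle t) \<in> ball c r"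
    "cocycle (to_circle t) \<phi> n x = v"
proof -
  define \<alpha> where "\<alpha> = to_circle t"
  let ?S = "cocycle \<alpha> \<phi>"
  have cont: "continuous_on A (?S n)" for A n
    using continuous_on_cocycle[OF \<phi>(1)] continuous_on_subset by blast
  have "\<exists>n x. x \<in> ball c r \<and> x + int_mult n \<alpha> \<in> ball c r \<and> \<bar>?S n x\<bar> = \<bar>v\<bar>"
  proof (rule ccontr)
    assume no: "\<not> ?thesis"
    obtain M where M: "finite M" "\<And>y. \<exists>m\<in>M. \<exists>x\<in>ball c (r / 2). y = x + int_mult m \<alpha>"
      unfolding \<alpha>_def by (rule finite_translates_cover[OF t, of "r / 2" c]) (use r in auto)
    have "\<exists>d>0. \<forall>x y. dist y x < d \<longrightarrow> \<bar>?S m y - ?S m x\<bar> < \<bar>v\<bar>" for m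
      using compact_uniformly_continuous[OF cont compact_UNIV_circle, of m] v
      by (auto simp: uniformly_continuous_on_def dist_real_def dest!: spec[of _ "\<bar>v\<bar>"])
    then obtain d where d: "\<And>m. d m > 0"
        "\<And>m x y. dist y x < d m \<Longrightarrow> \<bar>?S m y - ?S m x\<bar> < \<bar>v\<bar>"
      by metis
    \<comment> \<open>Two demands on the size of \<open>int_mult n \<alpha>\<close>: points of the
      half ball must stay in \<open>ball c r\<close> after the rotation, and every
      \<open>?S m\<close> with \<open>m \<in> M\<close> must vary by less than
      \<open>\<bar>v\<bar>\<close>.\<close>
    define \<delta> where "\<delta> = Min (insert (r / 2) (d ` M))"
    have \<delta>: "\<delta> > 0" "\<delta> \<le> r / 2" "\<And>m. m \<in> M \<Longrightarrow> \<delta> \<le> d m"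
      using M(1) d(1) r Min_le[of "insert (r / 2) (d ` M)" "r / 2"] by (auto simp: \<delta>_def)
    have bound: "\<bar>?S n y\<bar> < 2 * \<bar>v\<bar>" if n: "dist (int_mult n \<alpha>) 0 < \<delta>" for n y
    proof -
      have move: "dist (x + int_mult n \<alpha>) x < \<delta>" for x
        using n dist_circle_add_left[of x "int_mult n \<alpha>" 0] by simp
      have shift: "\<bar>?S n (x + int_mult m \<alpha>) - ?S n x\<bar> < \<bar>v\<bar>" if "m \<in> M" for x m
      proof -
        \<comment> \<open>Splitting time \<open>n + m\<close> in both orders exchanges the roles of
          \<open>n\<close> and \<open>m\<close>, so only the finitely many cocycles
          \<open>?S m\<close> need uniform continuity, whatever \<open>n\<close> is.\<close>
        have "?S n (x + int_mult m \<alpha>) - ?S n x = ?S m (x + int_mult n \<alpha>) - ?S m x"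
          using cocycle_add[of \<alpha> \<phi> n m x] cocycle_add[of \<alpha> \<phi> m n x] by (simp add: add.commute)
        then show ?thesis
          using d(2)[of "x + int_mult n \<alpha>" x m] move[of x] \<delta>(3)[OF that] by simp
      qed
      have avoid: "\<bar>?S n x\<bar> \<noteq> \<bar>v\<bar>" if "x \<in> ball c (r / 2)" for x
      proof -
        have "dist c (x + int_mult n \<alpha>) \<le> dist c x + dist (x + int_mult n \<alpha>) x"
          by (rule dist_triangle2)
        then have "x + int_mult n \<alpha> \<in> ball c r"
          using move[of x] \<delta>(2) that by simp
        moreover have "x \<in> ball c r" using that r by simp
        ultimately show ?thesis using no by blast
      qed
      obtain z where z: "?S n z = 0"
        by (rule integral_circle_zero_obtain[OF continuous_on_cocycle[OF \<phi>(1)] integral_cocycle[OF \<phi>]])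
      obtain m x where mx: "m \<in> M" "x \<in> ball c (r / 2)" "z = x + int_mult m \<alpha>"
        using M(2) by blast
      have x: "\<bar>?S n x\<bar> < \<bar>v\<bar>" using shift[OF mx(1), of x] z mx(3) by simp
      have conn: "connected ((\<lambda>x. \<bar>?S n x\<bar>) ` ball c (r / 2))"
        by (intro connected_continuous_image connected_ball_circle continuous_intros cont)
      have small: "\<bar>?S n x'\<bar> < \<bar>v\<bar>" if x': "x' \<in> ball c (r / 2)" for x'
      proof (rule ccontr)
        assume "\<not> \<bar>?S n x'\<bar> < \<bar>v\<bar>"
        then have "\<bar>v\<bar> \<in> (\<lambda>x. \<bar>?S n x\<bar>) ` ball c (r / 2)"
          using x by (intro connectedD_interval[OF conn imageI[OF mx(2)] imageI[OF x']]) simp_all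
        then show False using avoid by force
      qed
      obtain m' x' where "m' \<in> M" "x' \<in> ball c (r / 2)" "y = x' + int_mult m' \<alpha>"
        using M(2) by blast
      then show ?thesis using shift[of m' x'] small[of x'] by simp
    qed
    obtain N where N: "\<And>n. \<bar>n\<bar> \<ge> N \<Longrightarrow> \<bar>?S n (fst p)\<bar> \<ge> 2 * \<bar>v\<bar>"
      using disc unfolding discrete_orbit_iff \<alpha>_def by meson
    obtain n where "n \<ge> \<bar>N\<bar>" "dist (int_mult n \<alpha>) 0 < \<delta>"
      unfolding \<alpha>_def by (rule rotation_return[OF t \<delta>(1)])
    then show False using N[of n] bound[of n "fst p"] by force
  qed
  then obtain n x where nx: "x \<in> ball c r" "x + int_mult n \<alpha> \<in> ball c r" "\<bar>?S n x\<bar> = \<bar>v\<bar>"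
    by blast
  show thesis
  proof (cases "?S n x = v")
    case True
    then show thesis using that nx by (simp add: \<alpha>_def)
  next
    case False
    \<comment> \<open>The level \<open>- v\<close> was attained; reversing the orbit segment gives
      \<open>v\<close>, with start and end both in the ball.\<close>
    then have "?S (- n) (x + int_mult n \<alpha>) = v"
      using nx(3) by (simp add: cocycle_uminus abs_eq_iff)
    then show thesis
      using that[of "x + int_mult n \<alpha>" "- n"] nx by (simp add: \<alpha>_def int_mult_minus_left)
  qed
qed

text \<open>A rotation by time \<open>m\<close> brings \<open>c\<close> close to \<open>y\<close>
  and changes the height by about \<open>?S m c\<close>. A preceding return to a small ball about
  \<open>c\<close>, at level approximately \<open>v - ?S m c\<close>, corrects the height.\<close>

lemma cylindrical_transitive:
  assumes t: "t \<notin> \<rat>" and \<phi>: "continuous_on UNIV \<phi>" "(\<integral>x. \<phi> x \<partial>circle_measure) = 0"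
    and disc: "discrete_orbit (to_circle t) \<phi> p" and "r > 0" "e > 0"
  obtains n x where "x \<in> ball c r" "dist (x + int_mult n (to_circle t)) y < e"
    "\<bar>cocycle (to_circle t) \<phi> n x - v\<bar> < e"
proof -
  define \<alpha> where "\<alpha> = to_circle t"
  let ?S = "cocycle \<alpha> \<phi>"
  obtain m where m: "dist (c + int_mult m \<alpha>) y < e / 2"
    unfolding \<alpha>_def by (rule rotation_dense[OF t, of "e / 2" c y]) (use \<open>e > 0\<close> in auto)
  obtain d where d: "d > 0" "\<And>x. dist x c < d \<Longrightarrow> \<bar>?S m x - ?S m c\<bar> < e / 2"
    using continuous_on_cocycle[OF \<phi>(1), of \<alpha> m] \<open>e > 0\<close>
    unfolding continuous_on_iff dist_real_def by (metis UNIV_I half_gt_zero)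
  define \<rho> where "\<rho> = min r (min d (e / 2))"
  have \<rho>: "\<rho> > 0" "\<rho> \<le> r" "\<rho> \<le> d" "\<rho> \<le> e / 2"
    using \<open>r > 0\<close> \<open>e > 0\<close> d(1) by (auto simp: \<rho>_def)
  \<comment> \<open>\<open>cocycle_attains\<close> provides nonzero levels, so the level 0 is
    replaced by \<open>e / 4\<close>.\<close>
  obtain v' where v': "v' \<noteq> 0" "\<bar>v' - (v - ?S m c)\<bar> < e / 2"
  proof (cases "v - ?S m c = 0")
    case True
    then show ?thesis using that[of "e / 4"] \<open>e > 0\<close> by simp
  next
    case False
    then show ?thesis using that[of "v - ?S m c"] \<open>e > 0\<close> by simp
  qed
  obtain n x where nx: "x \<in> ball c \<rho>" "x + int_mult n \<alpha> \<in> ball c \<rho>" "?S n x = v'"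
    unfolding \<alpha>_def by (rule cocycle_attains[OF t \<phi> disc \<rho>(1) v'(1)])
  let ?z = "x + int_mult n \<alpha>"
  have "dist (?z + int_mult m \<alpha>) y \<le> dist (?z + int_mult m \<alpha>) (c + int_mult m \<alpha>) + dist (c + int_mult m \<alpha>) y"
    by (rule dist_triangle)
  also have "\<dots> < e" using nx(2) m \<rho>(4) by (simp add: dist_commute)
  finally have 1: "dist (x + int_mult (n + m) \<alpha>) y < e" by (simp add: int_mult_add add.assoc)
  have "?S (n + m) x = v' + ?S m ?z" by (simp add: cocycle_add nx(3))
  moreover have "\<bar>?S m ?z - ?S m c\<bar> < e / 2"
    using d(2)[of ?z] nx(2) \<rho>(3) by (simp add: dist_commute)
  ultimately have 2: "\<bar>?S (n + m) x - v\<bar> < e" using v'(2) by linarith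
  have "x \<in> ball c r" using nx(1) \<rho>(2) by simp
  then show thesis using that[of x "n + m"] 1 2 by (simp add: \<alpha>_def)
qed

text \<open>Baire category: a generic base point, started at height 0, has an orbit that approaches
  every rational target to every precision \<open>1 / Suc k\<close>.\<close>

theorem discrete_orbit_imp_dense_orbit:
  assumes t: "t \<notin> \<rat>" and \<phi>: "continuous_on UNIV \<phi>" "(\<integral>x. \<phi> x \<partial>circle_measure) = 0"
    and disc: "discrete_orbit (to_circle t) \<phi> p"
  shows "\<exists>p. dense_orbit (to_circle t) \<phi> p"
proof -
  define \<alpha> where "\<alpha> = to_circle t"
  let ?S = "cocycle \<alpha> \<phi>"
  \<comment> \<open>Base points are lifted to the line, where Baire's theorem is applied. Each
    \<open>D q v k\<close> is open by continuity of the cocycles and dense by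
    \<open>cylindrical_transitive\<close>; rational targets make the family countable.\<close>
  define D where "D q v k = (\<Union>n. {s. dist (to_circle s + int_mult n \<alpha>) (to_circle q) < 1 / Suc k
      \<and> \<bar>?S n (to_circle s) - v\<bar> < 1 / Suc k})" for q v :: real and k :: nat
  define \<G> where "\<G> = (\<lambda>(q, v, k). D q v k) ` (\<rat> \<times> \<rat> \<times> UNIV)"
  have "countable \<G>"
    unfolding \<G>_def by (intro countable_image countable_SIGMA countable_rat) auto
  moreover have "openin (top_of_set UNIV) T \<and> UNIV \<subseteq> closure T" if TG: "T \<in> \<G>" for T
  proof -
    obtain q v k where T: "T = D q v k" using TG by (auto simp: \<G>_def)
    have [continuous_intros]: "continuous_on UNIV (\<lambda>s. ?S n (to_circle s))" for n
      by (rule continuous_on_comp_to_circle[OF continuous_on_cocycle[OF \<phi>(1)]])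
    have [continuous_intros]: "continuous_on UNIV (\<lambda>s. to_circle s + z)" for z
      using continuous_on_compose2[OF continuous_on_circle_add[OF continuous_on_id] continuous_on_to_circle]
      by blast
    have "open T"
      unfolding T D_def by (intro open_UN ballI open_Collect_conj open_Collect_less continuous_intros)
    moreover have "UNIV \<subseteq> closure T"
    proof
      fix s
      show "s \<in> closure T"
        unfolding closure_approachable
      proof (intro allI impI)
        fix r :: real assume r: "r > 0"
        obtain n x where nx: "x \<in> ball (to_circle s) r" "dist (x + int_mult n \<alpha>) (to_circle q) < 1 / Suc k"
            "\<bar>?S n x - v\<bar> < 1 / Suc k"
          unfolding \<alpha>_def
          by (rule cylindrical_transitive[OF t \<phi> disc r, of "1 / Suc k" "to_circle s" "to_circle q" v]) auto
        then obtain s' where "s' \<in> ball s r" "x = to_circle s'" by (auto simp: ball_circle)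
        moreover have "s' \<in> T" if "x = to_circle s'" for s'
          using nx(2,3) that unfolding T D_def by blast
        ultimately show "\<exists>y\<in>T. dist y s < r" by (auto simp: dist_commute)
      qed
    qed
    ultimately show ?thesis by simp
  qed
  ultimately have "UNIV \<subseteq> closure (\<Inter>\<G>)"
    by (intro Baire) auto
  then have "\<Inter>\<G> \<noteq> {}" by force
  then obtain s where s: "s \<in> \<Inter>\<G>" by blast
  have "(y, v) \<in> closure (two_sided_orbit (cylindrical \<alpha> \<phi>) (to_circle s, 0))" for y v
    unfolding closure_approachable two_sided_orbit_cylindrical
  proof (intro allI impI)
    fix e :: real assume e: "e > 0"
    obtain b where b: "y = to_circle b" by (rule circle_cases)
    obtain k :: nat where k: "1 / Suc k < e / 4"
      using nat_approx_posE[of "e / 4"] e by auto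
    obtain q where q: "q \<in> \<rat>" "\<bar>q - b\<bar> < e / 4"
      using Rats_dense_in_real[of b "b + e / 4"] e by force
    obtain w where w: "w \<in> \<rat>" "\<bar>w - v\<bar> < e / 4"
      using Rats_dense_in_real[of v "v + e / 4"] e by force
    have "D q w k \<in> \<G>"
      unfolding \<G>_def by (rule image_eqI[of _ _ "(q, w, k)"]) (use q(1) w(1) in simp_all)
    then have "s \<in> D q w k" using s by blast
    then obtain n where n: "dist (to_circle s + int_mult n \<alpha>) (to_circle q) < 1 / Suc k"
        "\<bar>?S n (to_circle s) - w\<bar> < 1 / Suc k"
      by (auto simp: D_def)
    have "dist (to_circle q) y \<le> \<bar>q - b\<bar>" unfolding b by (rule dist_circle_le)
    then have 1: "dist (to_circle s + int_mult n \<alpha>) y < e / 2"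
      using dist_triangle[of "to_circle s + int_mult n \<alpha>" y "to_circle q"] n(1) k q(2) by linarith
    have 2: "dist (?S n (to_circle s)) v < e / 2"
      using n(2) k w(2) unfolding dist_real_def by linarith
    let ?z = "(to_circle s + int_mult n \<alpha>, 0 + ?S n (to_circle s))"
    have "dist ?z (y, v)
        \<le> dist (to_circle s + int_mult n \<alpha>) y + dist (?S n (to_circle s)) v"
      unfolding dist_Pair_Pair by (simp add: sqrt_sum_squares_le_sum)
    then have "dist ?z (y, v) < e" using 1 2 by linarith
    then show "\<exists>z\<in>range (\<lambda>n. (to_circle s + int_mult n \<alpha>, 0 + ?S n (to_circle s))). dist z (y, v) < e"
      by (rule bexI[OF _ rangeI])
  qed
  then have "dense_orbit \<alpha> \<phi> (to_circle s, 0)" unfolding dense_orbit_def by auto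
  then show ?thesis unfolding \<alpha>_def by blast
qed


section \<open>Construction of the function\<close>

lemma DC_irrational:
  assumes "\<alpha> \<in> DC a"
  obtains t where "\<alpha> = to_circle t" "t \<notin> \<rat>"
  using assms unfolding DC_def by blast

text \<open>With \<open>p\<close> the integer nearest to \<open>q\<close> times the lift,
  multiplying the Diophantine inequality by \<open>q\<close> lowers the exponent from
  \<open>1 + a\<close> to \<open>a\<close>.\<close>

lemma DC_dist_ge:
  assumes "\<alpha> \<in> DC a"
  obtains C where "C > 0"
    "\<And>q. q > 0 \<Longrightarrow> dist (int_mult q \<alpha>) 0 \<ge> 1 / (C * of_int q powr a)"
proof -
  obtain t C where t: "\<alpha> = to_circle t" and C: "C > 0"
    "\<And>p q :: int. q \<noteq> 0 \<Longrightarrow> \<bar>t - of_int p / of_int q\<bar> \<ge> 1 / (C * \<bar>of_int q\<bar> powr (1 + a))"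
    using assms unfolding DC_def by blast
  have "dist (int_mult q \<alpha>) 0 \<ge> 1 / (C * of_int q powr a)" if q: "q > 0" for q
  proof -
    obtain s where s: "dist (int_mult q \<alpha>) 0 = \<bar>s\<bar>" "int_mult q \<alpha> = to_circle s"
      by (rule dist_circle_obtain)
    obtain p :: int where "of_int q * t - s = of_int p"
      using s(2) by (auto simp: t int_mult_to_circle to_circle_eq_iff elim: Ints_cases)
    then have "s = of_int q * (t - of_int p / of_int q)" using q by (simp add: field_simps)
    then have "\<bar>s\<bar> = of_int q * \<bar>t - of_int p / of_int q\<bar>" using q by (simp add: abs_mult)
    also have "\<dots> \<ge> of_int q * (1 / (C * \<bar>of_int q\<bar> powr (1 + a)))"
      using C(2)[of q p] q by (intro mult_left_mono) auto
    also have "of_int q * (1 / (C * \<bar>of_int q\<bar> powr (1 + a))) = 1 / (C * of_int q powr a)"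
      using q C(1) by (simp add: powr_add field_simps)
    finally show ?thesis by (simp add: s(1))
  qed
  then show thesis using that C(1) by blast
qed

lemma holder_continuous_imp_continuous_on:
  assumes "holder_continuous \<gamma> f" "\<gamma> > 0"
  shows "continuous_on A f"
  unfolding continuous_on_def
proof
  fix x
  obtain K where K: "\<And>x y. dist (f x) (f y) \<le> K * dist x y powr \<gamma>"
    using assms(1) unfolding holder_continuous_def by blast
  have "((\<lambda>y. dist y x) \<longlongrightarrow> 0) (at x within A)"
    by (simp flip: tendsto_dist_iff)
  then have "((\<lambda>y. dist y x powr \<gamma>) \<longlongrightarrow> 0) (at x within A)"
    by (rule tendsto_zero_powrI[OF _ tendsto_const]) (use assms(2) in auto)
  then have "((\<lambda>y. K * dist y x powr \<gamma>) \<longlongrightarrow> 0) (at x within A)"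
    by (rule tendsto_mult_right_zero)
  then have "((\<lambda>y. dist (f y) (f x)) \<longlongrightarrow> 0) (at x within A)"
    by (rule Lim_null_comparison[rotated]) (simp add: K)
  then show "(f \<longlongrightarrow> f x) (at x within A)" by (rule tendsto_dist_iff[THEN iffD2])
qed

text \<open>Writing \<open>x\<close> as a product of its powers with exponents
  \<open>1 - \<gamma>\<close> and \<open>\<gamma>\<close> interpolates between a sup bound
  \<open>A\<close> and a Lipschitz bound \<open>B\<close>.\<close>

lemma min_le_powr_mult:
  fixes A B x :: real
  assumes "0 \<le> x" "x \<le> A" "x \<le> B" "0 \<le> \<gamma>" "\<gamma> \<le> 1"
  shows "x \<le> A powr (1 - \<gamma>) * B powr \<gamma>"
proof (cases "x = 0")
  case False
  then have "x = x powr (1 - \<gamma>) * x powr \<gamma>" using assms by (simp flip: powr_add)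
  also have "\<dots> \<le> A powr (1 - \<gamma>) * B powr \<gamma>"
    using assms by (intro mult_mono powr_mono2) auto
  finally show ?thesis .
qed auto

text \<open>The symmetry \<open>\<phi> (- x - \<alpha>) = - \<phi> x\<close> is recorded because it
  yields zero mean, by invariance of the measure under reflection and translation.\<close>

theorem DC_discrete_orbit:
  assumes a: "a \<ge> 1" and \<alpha>: "\<alpha> \<in> DC a" and \<gamma>: "0 < \<gamma>" "\<gamma> < 1 / (1 + a)"
  obtains \<phi> :: "circle \<Rightarrow> real" where "holder_continuous \<gamma> \<phi>"
    "\<And>x. \<phi> (- x - \<alpha>) = - \<phi> x" "discrete_orbit \<alpha> \<phi> (0, 0)"
proof -
  obtain t where t: "\<alpha> = to_circle t" "t \<notin> \<rat>" by (rule DC_irrational[OF \<alpha>])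
  obtain C where C: "C > 0" "\<And>q. q > 0 \<Longrightarrow> dist (int_mult q \<alpha>) 0 \<ge> 1 / (C * of_int q powr a)"
    using DC_dist_ge[OF \<alpha>] by metis
  \<comment> \<open>Half of the gap in \<open>\<gamma> * (1 + a) < 1\<close>: one half makes the
    Hoelder constants of the summands decay like \<open>2 powr (- \<eta> * k)\<close>, the other
    makes the cocycle grow like \<open>\<bar>n\<bar> powr \<eta>\<close>.\<close>
  define \<eta> where "\<eta> = (1 - \<gamma> * (1 + a)) / 2"
  have \<gamma>a: "\<gamma> * (1 + a) < 1" using \<gamma>(2) a by (simp add: field_simps)
  have "\<gamma> * a > 0" using \<gamma>(1) a by simp
  then have \<eta>: "\<eta> > 0" "\<eta> < 1" and \<gamma>1: "\<gamma> < 1"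
    using \<gamma>a \<gamma>(1) by (simp_all add: \<eta>_def distrib_left)
  have "\<exists>q. 0 < q \<and> q \<le> 2 ^ k \<and> dist (int_mult q \<alpha>) 0 \<le> 1 / 2 ^ k" for k :: nat
  proof -
    obtain h q where "0 < q" "q \<le> int (2 ^ k)" and hq: "\<bar>of_int q * t - of_int h\<bar> < 1 / (2 ^ k :: nat)"
      by (rule Dirichlet_approx[of "2 ^ k" t]) auto
    moreover have "int_mult q \<alpha> = to_circle (of_int q * t - of_int h)"
      by (simp add: t int_mult_to_circle to_circle_eq_iff)
    then have "dist (int_mult q \<alpha>) 0 \<le> 1 / 2 ^ k"
      using hq dist_circle_le[of "of_int q * t - of_int h" 0] by (simp add: to_circle_0)
    ultimately show ?thesis by auto
  qed
  then obtain q where q: "\<And>k. q k > 0" "\<And>k. q k \<le> 2 ^ k"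
      "\<And>k. dist (int_mult (q k) \<alpha>) 0 \<le> 1 / 2 ^ k"
    by metis
  have q_le: "of_int (q k) \<le> (2 ^ k :: real)" for k
  proof -
    have "real_of_int (q k) \<le> real_of_int (2 ^ k)" using q(2) by (simp only: of_int_le_iff)
    then show ?thesis by simp
  qed
  define \<epsilon> where "\<epsilon> k = dist (int_mult (q k) \<alpha>) 0" for k
  have \<epsilon>0: "\<epsilon> k > 0" for k
    using int_mult_irrational_nonzero[OF t(2), of "q k"] q(1)[of k] by (simp add: \<epsilon>_def t)
  have C\<epsilon>: "1 / \<epsilon> k \<le> C * 2 powr (a * k)" for k
  proof -
    have "1 \<le> \<epsilon> k * (C * of_int (q k) powr a)"
      using C(2)[OF q(1)[of k]] C(1) q(1)[of k] by (simp add: \<epsilon>_def divide_le_eq)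
    then have "1 / \<epsilon> k \<le> C * of_int (q k) powr a"
      using \<epsilon>0[of k] by (simp add: field_simps)
    also have "C * of_int (q k) powr a \<le> C * (2 ^ k) powr a"
      using C(1) q(1)[of k] q_le[of k] a by (intro mult_left_mono powr_mono2) auto
    also have "(2 ^ k :: real) powr a = 2 powr (a * k)"
      by (simp add: powr_powr mult.commute flip: powr_realpow)
    finally show ?thesis .
  qed
  define u where "u k = 2 powr ((\<eta> - 1) * k)" for k :: nat
  have u0: "u k > 0" for k by (simp add: u_def)
  \<comment> \<open>Dividing by \<open>\<epsilon> k\<close> normalises \<open>g k\<close> so that
    rotation by \<open>\<alpha>\<close> changes it by at most \<open>u k\<close>, while
    \<open>g k\<close> stays nonnegative and vanishes at 0.\<close>
  define g where "g k x = u k / \<epsilon> k * dist (int_mult (q k) x) 0" for k x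
  have g_nonneg: "g k x \<ge> 0" for k x using u0[of k] \<epsilon>0[of k] by (simp add: g_def)
  have g_0: "g k 0 = 0" for k by (simp add: g_def int_mult_zero)
  have g_minus: "g k (- x) = g k x" for k x
    using dist_circle_minus[of "int_mult (q k) x" 0] by (simp add: g_def int_mult_minus_right)
  have g_lip: "\<bar>g k x - g k y\<bar> \<le> u k / \<epsilon> k * dist (int_mult (q k) (x - y)) 0" for k x y
  proof -
    have "int_mult (q k) x = int_mult (q k) (x - y) + int_mult (q k) y"
      by (simp flip: int_mult_add_right)
    then have "dist (int_mult (q k) (x - y)) 0 = dist (int_mult (q k) x) (int_mult (q k) y)"
      using dist_circle_add[of "int_mult (q k) (x - y)" "int_mult (q k) y" 0] by simp
    then have "\<bar>dist (int_mult (q k) x) 0 - dist (int_mult (q k) y) 0\<bar> \<le> dist (int_mult (q k) (x - y)) 0"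
      using abs_dist_diff_le[of "int_mult (q k) x" 0 "int_mult (q k) y"] by (simp add: dist_commute)
    then have "u k / \<epsilon> k * \<bar>dist (int_mult (q k) x) 0 - dist (int_mult (q k) y) 0\<bar>
        \<le> u k / \<epsilon> k * dist (int_mult (q k) (x - y)) 0"
      using u0[of k] \<epsilon>0[of k] by (intro mult_left_mono) auto
    moreover have "u k / \<epsilon> k > 0" using u0[of k] \<epsilon>0[of k] by simp
    then have "\<bar>g k x - g k y\<bar>
        = u k / \<epsilon> k * \<bar>dist (int_mult (q k) x) 0 - dist (int_mult (q k) y) 0\<bar>"
      by (simp only: g_def abs_mult abs_of_pos flip: right_diff_distrib)
    ultimately show ?thesis by simp
  qed
  define f where "f k x = g k (x + \<alpha>) - g k x" for k x
  have f_bound: "\<bar>f k x\<bar> \<le> u k" for k x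
    using g_lip[of k "x + \<alpha>" x] \<epsilon>0[of k] by (simp add: f_def \<epsilon>_def)
  have summable_geo: "summable (\<lambda>k. 2 powr (- s * real k))" if "s > 0" for s :: real
  proof -
    have "summable (\<lambda>k. (2 powr (- s)) ^ k)"
      using that by (intro summable_geometric) (simp add: powr_less_one)
    then show ?thesis by (simp add: powr_powr flip: powr_realpow)
  qed
  have u_summable: "summable u"
    using summable_geo[of "1 - \<eta>"] \<eta>(2) by (simp add: u_def[abs_def])
  have f_summable: "summable (\<lambda>k. f k x)" for x
    by (rule summable_comparison_test'[OF u_summable]) (simp add: f_bound)
  define \<phi> where "\<phi> x = (\<Sum>k. f k x)" for x

  have f_holder: "\<bar>f k x - f k y\<bar> \<le> 2 * C powr \<gamma> * 2 powr (- \<eta> * k) * dist x y powr \<gamma>" for k x y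
  proof -
    \<comment> \<open>The factor \<open>2 powr ((1 + a) * k)\<close> combines
      \<open>q k \<le> 2 ^ k\<close> from multiplication on the circle with the bound
      \<open>C\<epsilon>\<close> on \<open>1 / \<epsilon> k\<close>.\<close>
    have g_lip': "\<bar>g k x - g k y\<bar> \<le> u k * C * 2 powr ((1 + a) * k) * dist x y" for x y
    proof -
      have "\<bar>g k x - g k y\<bar> \<le> u k / \<epsilon> k * dist (int_mult (q k) (x - y)) 0" by (rule g_lip)
      also have "\<dots> \<le> u k / \<epsilon> k * (2 ^ k * dist x y)"
      proof (rule mult_left_mono)
        have "dist (int_mult (q k) (x - y)) 0 \<le> of_int (q k) * dist x y"
          using dist_int_mult_le[of "q k" "x - y"] q(1)[of k] by (simp flip: dist_circle_diff)
        also have "of_int (q k) * dist x y \<le> 2 ^ k * dist x y"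
          by (intro mult_right_mono q_le) simp
        finally show "dist (int_mult (q k) (x - y)) 0 \<le> 2 ^ k * dist x y" .
      qed (use u0[of k] \<epsilon>0[of k] in auto)
      also have "\<dots> = 1 / \<epsilon> k * (u k * 2 ^ k * dist x y)" by simp
      also have "\<dots> \<le> C * 2 powr (a * k) * (u k * 2 ^ k * dist x y)"
        using C\<epsilon>[of k] u0[of k] by (intro mult_right_mono) auto
      also have "\<dots> = u k * C * 2 powr ((1 + a) * k) * dist x y"
        by (simp add: distrib_right powr_add powr_realpow)
      finally show ?thesis .
    qed
    have "\<bar>f k x - f k y\<bar> \<le> 2 * (u k * C * 2 powr ((1 + a) * k) * dist x y)"
      using g_lip'[of "x + \<alpha>" "y + \<alpha>"] g_lip'[of x y] by (simp add: f_def)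
    moreover have "\<bar>f k x - f k y\<bar> \<le> 2 * u k"
      using f_bound[of k x] f_bound[of k y] by simp
    ultimately have "\<bar>f k x - f k y\<bar>
        \<le> (2 * u k) powr (1 - \<gamma>) * (2 * (u k * C * 2 powr ((1 + a) * k) * dist x y)) powr \<gamma>"
      using \<gamma>(1) \<gamma>1 by (intro min_le_powr_mult) auto
    also have "\<dots> = ((2 * u k) powr (1 - \<gamma>) * (2 * u k) powr \<gamma>) * C powr \<gamma>
        * 2 powr ((1 + a) * k * \<gamma>) * dist x y powr \<gamma>"
      using u0[of k] C(1) by (simp add: powr_mult powr_powr mult_ac)
    also have "(2 * u k) powr (1 - \<gamma>) * (2 * u k) powr \<gamma> = 2 * u k"
      using u0[of k] by (simp flip: powr_add)
    also have "2 * u k * C powr \<gamma> * 2 powr ((1 + a) * k * \<gamma>) * dist x y powr \<gamma>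
        = 2 * C powr \<gamma> * 2 powr ((\<eta> - 1) * k + (1 + a) * k * \<gamma>) * dist x y powr \<gamma>"
      by (simp add: u_def powr_add)
    \<comment> \<open>By the choice of \<open>\<eta>\<close>,
      \<open>(1 + a) * \<gamma> = 1 - 2 * \<eta>\<close>.\<close>
    also have "(\<eta> - 1) * k + (1 + a) * k * \<gamma> = - \<eta> * k"
      by (simp add: \<eta>_def field_simps)
    finally show ?thesis .
  qed
  have holder: "holder_continuous \<gamma> \<phi>"
    unfolding holder_continuous_def
  proof (intro exI allI)
    fix x y :: circle
    let ?b = "\<lambda>k. 2 * C powr \<gamma> * 2 powr (- \<eta> * real k) * dist x y powr \<gamma>"
    have b: "summable ?b"
      by (intro summable_mult2 summable_mult summable_geo \<eta>(1))
    have abs: "summable (\<lambda>k. \<bar>f k x - f k y\<bar>)"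
      by (rule summable_comparison_test'[OF b]) (simp only: real_norm_def abs_abs f_holder)
    have "dist (\<phi> x) (\<phi> y) = \<bar>\<Sum>k. f k x - f k y\<bar>"
      by (simp add: \<phi>_def dist_real_def suminf_diff f_summable)
    also have "\<dots> \<le> (\<Sum>k. \<bar>f k x - f k y\<bar>)"
      by (rule summable_rabs[OF abs])
    also have "\<dots> \<le> (\<Sum>k. ?b k)"
      by (rule suminf_le[OF f_holder abs b])
    also have "\<dots> = (\<Sum>k. 2 * C powr \<gamma> * 2 powr (- \<eta> * real k)) * dist x y powr \<gamma>"
      by (intro suminf_mult2[symmetric] summable_mult summable_geo \<eta>(1))
    finally show "dist (\<phi> x) (\<phi> y)
        \<le> (\<Sum>k. 2 * C powr \<gamma> * 2 powr (- \<eta> * real k)) * dist x y powr \<gamma>" .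
  qed

  have odd: "\<phi> (- x - \<alpha>) = - \<phi> x" for x
  proof -
    \<comment> \<open>Since \<open>g k\<close> is even, the reflection swaps its values at
      \<open>x\<close> and \<open>x + \<alpha>\<close>.\<close>
    have "f k (- x - \<alpha>) = - f k x" for k
      using g_minus[of k x] g_minus[of k "x + \<alpha>"] by (simp add: f_def)
    then show ?thesis by (simp add: \<phi>_def suminf_minus f_summable)
  qed

  \<comment> \<open>Along the orbit of 0, \<open>g k (int_mult n \<alpha>)\<close> is at most
    \<open>\<bar>n\<bar> * u k\<close>, so the transfer functions can be summed there and the
    coboundaries telescope from \<open>g k 0 = 0\<close>.\<close>
  have summable_g: "summable (\<lambda>k. g k (int_mult n \<alpha>))" and
    cocycle_eq: "cocycle \<alpha> \<phi> n 0 = (\<Sum>k. g k (int_mult n \<alpha>))" for n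
  proof -
    show s: "summable (\<lambda>k. g k (int_mult n \<alpha>))" for n
    proof (rule summable_comparison_test'[OF summable_mult[OF u_summable, of "\<bar>of_int n\<bar>"]])
      fix k :: nat
      have "g k (int_mult n \<alpha>) = u k / \<epsilon> k * dist (int_mult n (int_mult (q k) \<alpha>)) 0"
        by (simp add: g_def int_mult_assoc mult.commute)
      also have "\<dots> \<le> u k / \<epsilon> k * (\<bar>of_int n\<bar> * \<epsilon> k)"
        unfolding \<epsilon>_def using u0[of k] by (intro mult_left_mono dist_int_mult_le) auto
      also have "\<dots> = \<bar>of_int n\<bar> * u k" using \<epsilon>0[of k] by simp
      finally show "norm (g k (int_mult n \<alpha>)) \<le> \<bar>of_int n\<bar> * u k" using g_nonneg by simp
    qed
    show "cocycle \<alpha> \<phi> n 0 = (\<Sum>k. g k (int_mult n \<alpha>))"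
    proof (rule cocycle_unique)
      show "(\<Sum>k. g k (int_mult 0 \<alpha>)) = 0" by (simp add: int_mult_0 g_0)
      fix n
      have "g k (int_mult (n + 1) \<alpha>) = g k (int_mult n \<alpha>) + f k (0 + int_mult n \<alpha>)" for k
        by (simp add: f_def int_mult_add int_mult_1)
      then show "(\<Sum>k. g k (int_mult (n + 1) \<alpha>)) = (\<Sum>k. g k (int_mult n \<alpha>)) + \<phi> (0 + int_mult n \<alpha>)"
        using suminf_add[OF s f_summable] by (simp add: \<phi>_def)
    qed
  qed
  have cocycle_ge: "cocycle \<alpha> \<phi> n 0 \<ge> \<bar>of_int n\<bar> powr \<eta> / 4" if "n \<noteq> 0" for n
  proof -
    \<comment> \<open>The least such \<open>k\<close> satisfies
      \<open>2 * \<bar>n\<bar> \<le> 2 ^ k \<le> 4 * \<bar>n\<bar>\<close>. The first bound keeps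
      \<open>n\<close> times the \<open>k\<close>-th displacement within 1/2, so it does not wrap
      around; the second produces the factor 1/4.\<close>
    define k where "k = (LEAST k. 2 * \<bar>n\<bar> \<le> 2 ^ k)"
    obtain k' :: nat where "real_of_int (2 * \<bar>n\<bar>) < 2 ^ k'"
      using real_arch_pow[of 2 "real_of_int (2 * \<bar>n\<bar>)"] by auto
    then have "real_of_int (2 * \<bar>n\<bar>) < real_of_int (2 ^ k')" by simp
    then have "2 * \<bar>n\<bar> < 2 ^ k'" by (simp only: of_int_less_iff)
    then have "\<exists>k::nat. 2 * \<bar>n\<bar> \<le> 2 ^ k" by (intro exI[of _ k']) simp
    then have k: "2 * \<bar>n\<bar> \<le> 2 ^ k" unfolding k_def by (rule LeastI_ex)
    have k0: "k > 0" using k that by (cases k) auto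
    then have "\<not> 2 * \<bar>n\<bar> \<le> 2 ^ (k - 1)" unfolding k_def by (intro not_less_Least) auto
    then have k': "2 ^ k \<le> 4 * \<bar>n\<bar>" using k0 by (cases k) auto
    have "real_of_int (2 * \<bar>n\<bar>) \<le> real_of_int (2 ^ k)" "real_of_int (2 ^ k) \<le> real_of_int (4 * \<bar>n\<bar>)"
      using k k' by (simp_all only: of_int_le_iff)
    then have kr: "2 * \<bar>of_int n\<bar> \<le> (2 ^ k :: real)" "2 ^ k \<le> 4 * \<bar>of_int n :: real\<bar>"
      by simp_all
    have "\<bar>of_int n\<bar> * \<epsilon> k \<le> \<bar>of_int n\<bar> * (1 / 2 ^ k)"
      unfolding \<epsilon>_def by (intro mult_left_mono q(3)) auto
    also have "\<dots> \<le> 1 / 2" using kr(1) by (simp add: field_simps)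
    finally have "dist (int_mult n (int_mult (q k) \<alpha>)) 0 = \<bar>of_int n\<bar> * \<epsilon> k"
      unfolding \<epsilon>_def by (rule dist_int_mult_small)
    then have "g k (int_mult n \<alpha>) = u k * \<bar>of_int n\<bar>"
      using \<epsilon>0[of k] by (simp add: g_def int_mult_assoc mult.commute)
    also have "u k = 2 powr (\<eta> * k) / 2 powr k"
      by (simp add: u_def left_diff_distrib powr_diff)
    also have "2 powr (\<eta> * k) = (2 ^ k) powr \<eta>"
      by (simp add: powr_powr mult.commute flip: powr_realpow)
    also have "2 powr k = (2 ^ k :: real)" by (simp add: powr_realpow)
    finally have "g k (int_mult n \<alpha>) = (2 ^ k) powr \<eta> * (\<bar>of_int n\<bar> / 2 ^ k)" by simp
    moreover have "\<bar>of_int n\<bar> powr \<eta> * (1 / 4) \<le> (2 ^ k) powr \<eta> * (\<bar>of_int n\<bar> / 2 ^ k)"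
      using kr \<eta>(1) by (intro mult_mono powr_mono2) (auto simp: field_simps)
    ultimately have "\<bar>of_int n\<bar> powr \<eta> / 4 \<le> g k (int_mult n \<alpha>)" by simp
    \<comment> \<open>All terms are nonnegative, so a single one bounds the sum from below.\<close>
    also have "g k (int_mult n \<alpha>) \<le> (\<Sum>k. g k (int_mult n \<alpha>))"
      using sum_le_suminf[OF summable_g, of "{k}"] g_nonneg by simp
    finally show ?thesis by (simp add: cocycle_eq)
  qed
  have "discrete_orbit \<alpha> \<phi> (0, 0)"
    unfolding discrete_orbit_iff
  proof (intro allI)
    fix Z :: real
    have "\<exists>N. \<forall>n. \<bar>n\<bar> \<ge> N \<longrightarrow> Z \<le> \<bar>of_int n\<bar> powr \<eta> / 4"
    proof (intro exI allI impI)
      fix n :: int assume "\<bar>n\<bar> \<ge> \<lceil>(4 * \<bar>Z\<bar>) powr (1 / \<eta>)\<rceil>"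
      then have "(4 * \<bar>Z\<bar>) powr (1 / \<eta>) \<le> \<bar>of_int n\<bar>" by linarith
      then have "((4 * \<bar>Z\<bar>) powr (1 / \<eta>)) powr \<eta> \<le> \<bar>of_int n\<bar> powr \<eta>"
        using \<eta>(1) by (intro powr_mono2) auto
      then show "Z \<le> \<bar>of_int n\<bar> powr \<eta> / 4" using \<eta>(1) by (simp add: powr_powr)
    qed
    then obtain N where N: "\<And>n. \<bar>n\<bar> \<ge> N \<Longrightarrow> Z \<le> \<bar>of_int n\<bar> powr \<eta> / 4" by blast
    \<comment> \<open>The maximum with 1 excludes \<open>n = 0\<close>, where
      \<open>cocycle_ge\<close> does not apply.\<close>
    have "Z \<le> \<bar>cocycle \<alpha> \<phi> n 0\<bar>" if "\<bar>n\<bar> \<ge> max N 1" for n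
      using N[of n] cocycle_ge[of n] that by fastforce
    then show "\<exists>N. \<forall>n. \<bar>n\<bar> \<ge> N \<longrightarrow> Z \<le> \<bar>cocycle \<alpha> \<phi> n (fst (0, 0))\<bar>"
      unfolding fst_conv by blast
  qed
  then show thesis using that holder odd by blast
qed

theorem theorem3:
  fixes a \<gamma> :: real and \<alpha> :: circle
  assumes "a \<ge> 1" and "\<alpha> \<in> DC a" and "0 < \<gamma>" and "\<gamma> < 1 / ((1 + a) * a)"
  shows "\<exists>\<phi> :: circle \<Rightarrow> real.
    holder_continuous \<gamma> \<phi> \<and> (\<integral>x. \<phi> x \<partial>circle_measure) = 0 \<and> besicovitch \<alpha> \<phi>"
proof -
  have "1 / ((1 + a) * a) \<le> 1 / (1 + a)"
    using assms(1) mult_left_mono[of 1 a "1 + a"] by (intro divide_left_mono) auto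
  then have \<gamma>: "\<gamma> < 1 / (1 + a)" using assms(4) by linarith
  obtain \<phi> :: "circle \<Rightarrow> real" where \<phi>: "holder_continuous \<gamma> \<phi>" "\<And>x. \<phi> (- x - \<alpha>) = - \<phi> x"
      "discrete_orbit \<alpha> \<phi> (0, 0)"
    by (rule DC_discrete_orbit[OF assms(1,2,3) \<gamma>]) blast
  have cont: "continuous_on UNIV \<phi>"
    by (rule holder_continuous_imp_continuous_on[OF \<phi>(1) assms(3)])
  \<comment> \<open>Reflection and translation invariance combined with the symmetry of
    \<open>\<phi>\<close> make the integral equal to its own negative.\<close>
  have "(\<integral>x. \<phi> x \<partial>circle_measure) = (\<integral>x. \<phi> (- x + - \<alpha>) \<partial>circle_measure)"
    using integral_circle_reflect[OF continuous_on_circle_add[OF cont, of "- \<alpha>"]]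
      integral_circle_translate[OF cont, of "- \<alpha>"] by simp
  also have "\<dots> = - (\<integral>x. \<phi> x \<partial>circle_measure)" by (simp add: \<phi>(2))
  finally have int: "(\<integral>x. \<phi> x \<partial>circle_measure) = 0" by simp
  obtain t where t: "\<alpha> = to_circle t" "t \<notin> \<rat>" by (rule DC_irrational[OF assms(2)])
  then have "\<exists>p. dense_orbit \<alpha> \<phi> p"
    using discrete_orbit_imp_dense_orbit[OF t(2) cont int] \<phi>(3) by simp
  then show ?thesis
    using \<phi>(1,3) int unfolding besicovitch_def by blast
qed

end
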